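(* Let $M=(E,\mathcal{B})$ be any matroid of rank $r$ with ground set $E$ and set of bases $\mathcal{B}$, and let $0\le m\le r$. Let $\mathcal{T}=(T_1,\dots,T_{r-m})$ be a sequence of subsets of $E$ and let $Q,R\subseteq E$ be subsets. For $0\le k\le m$ define $$B_k(\mathcal{T},Q,R):=B(T_1,\dots,T_{r-m},\underbrace{Q,\dots,Q}_{k\text{ times}},\underbrace{R,\dots,R}_{m-k\text{ times}}).$$ Then the sequence $B_0(\mathcal{T},Q,R),\dots,B_m(\mathcal{T},Q,R)$ is log-concave.
   Context: For subsets $S_1,\dots,S_r\subseteq E$ of the ground set of a matroid of rank $r$, $B(S_1,\dots,S_r)$ is the number of sequences $(y_1,\dots,y_r)\in S_1\times\cdots\times S_r$ such that $\{y_1,\dots,y_r\}\in\mathcal{B}$. A sequence $a_0,\dots,a_m$ of non-negative reals is log-concave if $a_k^2\ge a_{k-1}a_{k+1}$ for all $1\le k\le m-1$. *)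

theory Defs
  imports Complex_Main
begin

locale matroid =
  fixes E :: "'a set" and \<B> :: "'a set set"
  assumes finite_ground: "finite E"
    and basis_subset: "B \<in> \<B> \<Longrightarrow> B \<subseteq> E"
    and bases_nonempty: "\<B> \<noteq> {}"
    and basis_exchange: "\<lbrakk>A \<in> \<B>; B \<in> \<B>; a \<in> A - B\<rbrakk>
      \<Longrightarrow> \<exists>b \<in> B - A. insert b (A - {a}) \<in> \<B>"

text \<open>The choice of basis is immaterial by \<open>card_basis\<close> below.\<close>

definition matroid_rank :: "'a set set \<Rightarrow> nat" where
  "matroid_rank \<B> = card (SOME B. B \<in> \<B>)"

context matroid
begin

lemma card_basis_le:
  assumes "A \<in> \<B>" "B \<in> \<B>"
  shows "card A \<le> card B"
  using assms
proof (induction "card (A - B)" arbitrary: A rule: less_induct)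
  case less
  have fin: "finite A" "finite B"
    using less.prems basis_subset finite_ground finite_subset by blast+
  show ?case
  proof (cases "A \<subseteq> B")
    case True
    then show ?thesis using fin by (simp add: card_mono)
  next
    case False
    then obtain a where a: "a \<in> A - B" by blast
    then obtain b where b: "b \<in> B - A" "insert b (A - {a}) \<in> \<B>"
      using basis_exchange less.prems by blast
    have "insert b (A - {a}) - B = (A - B) - {a}" using b by blast
    then have "card (insert b (A - {a}) - B) < card (A - B)"
      using a fin by (metis card_Diff1_less finite_Diff)
    then have "card (insert b (A - {a})) \<le> card B"
      using less b by blast
    moreover have "card (insert b (A - {a})) = card A"
      using a b fin card_Suc_Diff1[of A a] by simp
    ultimately show ?thesis by simp
  qed
qed

lemma card_basis:
  assumes "B \<in> \<B>"
  shows "card B = matroid_rank \<B>"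
proof -
  have "(SOME B. B \<in> \<B>) \<in> \<B>"
    using assms by (rule someI)
  then show ?thesis
    unfolding matroid_rank_def using assms by (intro antisym card_basis_le)
qed

end

text \<open>
  \<open>listset [S\<^sub>1, S\<^sub>2]\<close> is the set of lists \<open>[y\<^sub>1, y\<^sub>2]\<close> with \<open>y\<^sub>1 \<in> S\<^sub>1\<close>, \<open>y\<^sub>2 \<in> S\<^sub>2\<close>,
  and so on for longer lists. If the list of sets has length the rank of the matroid, then a list
  with a repeated entry is never counted, its set of entries being too small to be a basis.
\<close>

definition basis_count :: "'a set set \<Rightarrow> 'a set list \<Rightarrow> nat" where
  "basis_count \<B> Ss = card {ys \<in> listset Ss. set ys \<in> \<B>}"

definition mixed_basis_count ::
  "'a set set \<Rightarrow> nat \<Rightarrow> 'a set list \<Rightarrow> 'a set \<Rightarrow> 'a set \<Rightarrow> nat \<Rightarrow> nat" where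
  "mixed_basis_count \<B> m T Q R k = basis_count \<B> (T @ replicate k Q @ replicate (m - k) R)"

text \<open>Log-concavity of the finite sequence \<open>a 0, \<dots>, a m\<close>.\<close>

definition log_concave :: "nat \<Rightarrow> (nat \<Rightarrow> real) \<Rightarrow> bool" where
  "log_concave m a \<longleftrightarrow>
     (\<forall>k\<le>m. 0 \<le> a k) \<and>
     (\<forall>k. 1 \<le> k \<and> k < m \<longrightarrow> (a k)\<^sup>2 \<ge> a (k - 1) * a (k + 1))"

end

theory Submission
  imports Defs "HOL-Analysis.Function_Topology" "HOL-Library.Indicator_Function"
begin

text \<open>
  Write \<open>F(v\<^sub>1, \<dots>, v\<^sub>r)\<close> for the sum of \<open>v\<^sub>1(y\<^sub>1) \<cdots> v\<^sub>r(y\<^sub>r)\<close> over all ordered bases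
  \<open>(y\<^sub>1, \<dots>, y\<^sub>r)\<close>. This form is symmetric and multilinear, and its value on indicator functions
  is \<open>B(S\<^sub>1, \<dots>, S\<^sub>r)\<close>. So it suffices to show the Alexandrov--Fenchel inequality
  \<open>F(x, x, w) F(y, y, w) \<le> F(x, y, w)\<^sup>2\<close> for non-negative \<open>x\<close>, \<open>y\<close>, \<open>w\<close>, by perturbation for
  positive ones, and this goes by induction on the rank through a Bochner argument. Let \<open>w = (v, w')\<close>.
  The inequality for the contractions \<open>M/i\<close> with arguments \<open>x\<close>, \<open>v\<close>, \<open>w'\<close>, divided by
  \<open>F(e\<^sub>i, v, v, w')\<close>, weighted by \<open>v(i)\<close> and summed over \<open>i\<close>, says that the matrix of
  \<open>F(\<cdot>, \<cdot>, v, w')\<close>, normalised to a stochastic matrix, has no eigenvalue strictly between 0 and 1.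
  The eigenvalue 1 is simple by connectedness, so on the complement of its eigenvector the form is
  negative semidefinite.
\<close>

section \<open>Contractions and the basis form\<close>

text \<open>At a loop this gives the empty family, where the usual contraction would delete the
  loop, so that loops drop out of all sums.\<close>

definition contract :: "'a \<Rightarrow> 'a set set \<Rightarrow> 'a set set" where
  "contract i \<B> = {B. i \<notin> B \<and> insert i B \<in> \<B>}"

text \<open>The empty family is allowed, since contracting a loop produces it.\<close>

definition basis_system :: "'a set \<Rightarrow> nat \<Rightarrow> 'a set set \<Rightarrow> bool" where
  "basis_system E r \<B> \<longleftrightarrow> finite E \<and> (\<forall>B\<in>\<B>. B \<subseteq> E \<and> card B = r) \<and>
     (\<forall>A\<in>\<B>. \<forall>B\<in>\<B>. \<forall>a\<in>A - B. \<exists>b\<in>B - A. insert b (A - {a}) \<in> \<B>)"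

text \<open>Contracting at y_1, ..., y_r in turn leaves \<open>{}\<close> in the family exactly when
  these elements are distinct and form a member of \<B>. Hence this is the form F, built one
  contraction at a time.\<close>

fun basis_form :: "'a set \<Rightarrow> 'a set set \<Rightarrow> ('a \<Rightarrow> real) list \<Rightarrow> real" where
  "basis_form E \<B> [] = (if {} \<in> \<B> then 1 else 0)"
| "basis_form E \<B> (v # vs) = (\<Sum>i\<in>E. v i * basis_form E (contract i \<B>) vs)"

lemma contract_commute: "contract i (contract j \<B>) = contract j (contract i \<B>)"
  by (auto simp: contract_def insert_commute)

lemma contract_nonbasis: "i \<notin> \<Union>\<B> \<Longrightarrow> contract i \<B> = {}"
  by (auto simp: contract_def)

lemma contract_in_basis: "B \<in> \<B> \<Longrightarrow> i \<in> B \<Longrightarrow> B - {i} \<in> contract i \<B>"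
  by (auto simp: contract_def insert_absorb)

lemma basis_system_contract:
  assumes "basis_system E (Suc r) \<B>"
  shows "basis_system E r (contract i \<B>)"
proof -
  have fin: "finite E" and sub: "B \<subseteq> E" "card B = Suc r" if "B \<in> \<B>" for B
    using assms that by (auto simp: basis_system_def)
  have ex: "\<exists>b\<in>B - A. insert b (A - {a}) \<in> \<B>" if "A \<in> \<B>" "B \<in> \<B>" "a \<in> A - B" for A B a
    using assms that by (auto simp: basis_system_def)
  have "B \<subseteq> E \<and> card B = r" if "B \<in> contract i \<B>" for B
  proof -
    have i: "i \<notin> B" and B: "insert i B \<in> \<B>" using that by (auto simp: contract_def)
    have "finite B" using fin sub B by (meson finite_insert finite_subset)
    then show ?thesis using sub[OF B] i by auto
  qed
  moreover have "\<exists>b\<in>B - A. insert b (A - {a}) \<in> contract i \<B>"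
    if "A \<in> contract i \<B>" "B \<in> contract i \<B>" "a \<in> A - B" for A B a
  proof -
    have i: "i \<notin> A" "i \<notin> B" and AB: "insert i A \<in> \<B>" "insert i B \<in> \<B>"
      using that by (auto simp: contract_def)
    have "a \<in> insert i A - insert i B" using that i by auto
    from ex[OF AB this] obtain b
      where b: "b \<in> insert i B - insert i A" "insert b (insert i A - {a}) \<in> \<B>"
      by (elim bexE)
    have "insert b (insert i A - {a}) = insert i (insert b (A - {a}))"
      using that i by auto
    then show ?thesis using b i by (intro bexI[of _ b]) (auto simp: contract_def)
  qed
  moreover have "finite E" using assms by (simp add: basis_system_def)
  ultimately show ?thesis by (simp add: basis_system_def)
qed

lemma basis_form_empty [simp]: "basis_form E {} vs = 0"
  by (induction vs) (auto simp: contract_def)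

lemma basis_form_nonneg:
  "(\<And>v i. v \<in> set vs \<Longrightarrow> i \<in> E \<Longrightarrow> 0 \<le> v i) \<Longrightarrow> 0 \<le> basis_form E \<B> vs"
  by (induction vs arbitrary: \<B>) (auto intro!: sum_nonneg)

lemma basis_form_pos:
  assumes "finite E" "B \<in> \<B>" "B \<subseteq> E" "card B = length vs"
    and "\<And>v i. v \<in> set vs \<Longrightarrow> i \<in> E \<Longrightarrow> 0 < v i"
  shows "0 < basis_form E \<B> vs"
  using assms
proof (induction vs arbitrary: \<B> B)
  case Nil
  then show ?case using finite_subset by fastforce
next
  case (Cons v vs)
  have finB: "finite B" using Cons.prems finite_subset by blast
  obtain i where i: "i \<in> B" using Cons.prems(4) by fastforce
  have "0 < basis_form E (contract i \<B>) vs"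
    using Cons.prems i finB
    by (intro Cons.IH[of "B - {i}"]) (auto intro: contract_in_basis)
  moreover have "0 \<le> v j * basis_form E (contract j \<B>) vs" if "j \<in> E" for j
    using Cons.prems(5) that
    by (intro mult_nonneg_nonneg basis_form_nonneg) (simp_all add: less_imp_le)
  ultimately show ?case
    using Cons.prems i by (auto intro!: sum_pos2[of _ i])
qed

text \<open>Contractions commute, so interchanging the two outer sums suffices.\<close>

lemma basis_form_swap: "basis_form E \<B> (u # v # ws) = basis_form E \<B> (v # u # ws)"
  by (simp add: sum_distrib_left, subst sum.swap)
    (auto intro!: sum.cong simp: contract_commute mult.left_commute)

lemma basis_form_move_front: "basis_form E \<B> (us @ v # ws) = basis_form E \<B> (v # us @ ws)"
proof (induction us arbitrary: \<B>)
  case (Cons u us)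
  have "basis_form E \<B> ((u # us) @ v # ws) = basis_form E \<B> (u # v # us @ ws)"
    using Cons.IH by simp
  then show ?case using basis_form_swap[of E \<B> u v "us @ ws"] by simp
qed simp

lemma isCont_basis_form_shift:
  "isCont (\<lambda>e. basis_form E \<B> (map (\<lambda>v i. v i + e) vs)) t"
  by (induction vs arbitrary: \<B>) (auto intro!: continuous_intros)

text \<open>Sorting the lists by their first entry \<open>i\<close> turns the count for \<B> into
  counts for \<open>contract i \<B>\<close>, which is the recursion of
  \<open>basis_form\<close>.\<close>

lemma basis_count_eq_basis_form:
  assumes "finite E" "\<And>B. B \<in> \<B> \<Longrightarrow> card B = length Ss" "\<And>S. S \<in> set Ss \<Longrightarrow> S \<subseteq> E"
  shows "real (basis_count \<B> Ss) = basis_form E \<B> (map indicator Ss)"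
  using assms
proof (induction Ss arbitrary: \<B>)
  case Nil
  have "{ys. ys = [] \<and> set ys \<in> \<B>} = (if {} \<in> \<B> then {[]} else {})" by auto
  then show ?case by (simp add: basis_count_def)
next
  case (Cons S Ss)
  have SE: "S \<subseteq> E" using Cons.prems by simp
  then have fS: "finite S" using Cons.prems(1) finite_subset by blast
  have len: "length ys = length Ss" if "ys \<in> listset Ss" for ys
    using that by (induction Ss arbitrary: ys) (auto simp: set_Cons_def)
  have fin: "finite (listset Ss)"
  proof -
    have "listset Ts \<subseteq> {ys. set ys \<subseteq> E \<and> length ys = length Ts}"
      if "\<And>T. T \<in> set Ts \<Longrightarrow> T \<subseteq> E" for Ts :: "'a set list"
      using that by (induction Ts) (fastforce simp: set_Cons_def)+
    then have "listset Ss \<subseteq> {ys. set ys \<subseteq> E \<and> length ys = length Ss}" using Cons.prems by auto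
    then show ?thesis using Cons.prems(1) finite_lists_length_eq finite_subset by blast
  qed
  \<comment> \<open>Here the cardinality hypothesis enters: with \<open>i\<close> repeated, the
    entries would be too few for a basis.\<close>
  have eq: "{ys \<in> listset Ss. set (i # ys) \<in> \<B>} = {ys \<in> listset Ss. set ys \<in> contract i \<B>}" for i
  proof -
    have "i \<notin> set ys" if "ys \<in> listset Ss" "set (i # ys) \<in> \<B>" for ys
    proof
      assume "i \<in> set ys"
      then have "card (set (i # ys)) \<le> length ys" by (simp add: insert_absorb card_length)
      then show False using Cons.prems(2)[OF that(2)] len[OF that(1)] by simp
    qed
    then show ?thesis by (auto simp: contract_def)
  qed
  have "{ys \<in> listset (S # Ss). set ys \<in> \<B>}
      = (\<Union>i\<in>S. (#) i ` {ys \<in> listset Ss. set (i # ys) \<in> \<B>})"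
    by (auto simp: set_Cons_def)
  also have "card \<dots> = (\<Sum>i\<in>S. card ((#) i ` {ys \<in> listset Ss. set (i # ys) \<in> \<B>}))"
    using fS fin by (intro card_UN_disjoint) auto
  also have "\<dots> = (\<Sum>i\<in>S. basis_count (contract i \<B>) Ss)"
    by (intro sum.cong refl, subst card_image) (auto simp: eq[simplified] basis_count_def)
  finally have "real (basis_count \<B> (S # Ss)) = (\<Sum>i\<in>S. real (basis_count (contract i \<B>) Ss))"
    by (simp add: basis_count_def)
  also have "\<dots> = (\<Sum>i\<in>S. basis_form E (contract i \<B>) (map indicator Ss))"
  proof (intro sum.cong refl Cons.IH)
    fix i B assume "B \<in> contract i \<B>"
    then have "i \<notin> B" "insert i B \<in> \<B>" by (auto simp: contract_def)
    with Cons.prems(2)[of "insert i B"] show "card B = length Ss"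
      by (cases "finite B") auto
  qed (use Cons.prems in auto)
  also have "\<dots> = basis_form E \<B> (map indicator (S # Ss))"
    using Cons.prems(1) SE by (simp add: sum_indicator_mult Collect_conj_eq Int_absorb1)
  finally show ?case .
qed

section \<open>Real quadratic forms and their maximisers\<close>

text \<open>The first-order condition at an extremum: near 0 the quadratic term is negligible
  against the linear one.\<close>

lemma linear_le_quadratic_imp_zero:
  fixes \<beta> \<gamma> :: real
  assumes "\<And>t. t * \<beta> \<le> t\<^sup>2 * \<gamma>"
  shows "\<beta> = 0"
proof (rule ccontr)
  assume "\<beta> \<noteq> 0"
  \<comment> \<open>Since \<open>c\<close> is positive and exceeds \<gamma>, the choice
    \<open>t = \<beta> / c\<close> makes the linear side too large.\<close>
  define c where "c = \<bar>\<gamma>\<bar> + 1"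
  have c: "c > 0" "\<gamma> < c" by (auto simp: c_def)
  have "(\<beta> / c) * \<beta> \<le> (\<beta> / c)\<^sup>2 * \<gamma>" by (rule assms)
  then have "\<beta>\<^sup>2 * c \<le> \<beta>\<^sup>2 * \<gamma>" using c by (simp add: field_simps power2_eq_square)
  then show False using c \<open>\<beta> \<noteq> 0\<close> by simp
qed

text \<open>Every plane meets the kernel of \<open>l\<close> nontrivially, so the form is not
  positive definite on any plane; hence the Gram determinant of \<open>x\<close> and
  \<open>y\<close> cannot be positive.\<close>

lemma reverse_cauchy_schwarz:
  fixes E :: "'a set" and a :: "'a \<Rightarrow> 'a \<Rightarrow> real" and l :: "'a \<Rightarrow> real"
  defines "A \<equiv> \<lambda>x y. \<Sum>i\<in>E. \<Sum>j\<in>E. a i j * x i * y j"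
  assumes sym: "\<And>i j. a i j = a j i"
    and neg: "\<And>z. (\<Sum>i\<in>E. l i * z i) = 0 \<Longrightarrow> A z z \<le> 0"
    and y: "0 \<le> A y y"
  shows "A x x * A y y \<le> (A x y)\<^sup>2"
proof (rule ccontr)
  assume "\<not> ?thesis"
  then have det: "A x x * A y y > (A x y)\<^sup>2" by simp
  then have Ay: "A y y > 0" using y by (cases "A y y = 0") auto
  define L where "L z = (\<Sum>i\<in>E. l i * z i)" for z
  \<comment> \<open>These coefficients put \<open>z\<close> into the kernel of
    \<open>L\<close>.\<close>
  define p q where "p = L y" and "q = - L x"
  define z where "z = (\<lambda>i. p * x i + q * y i)"
  have symA: "A y x = A x y"
    unfolding A_def by (subst sum.swap) (auto intro!: sum.cong simp: sym mult_ac)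
  have "L z = p * L x + q * L y"
    by (simp add: L_def z_def sum_distrib_left sum.distrib distrib_left mult_ac)
  then have "L z = 0" by (simp add: p_def q_def)
  then have "A z z \<le> 0" using neg by (simp add: L_def)
  moreover have "A z z = p\<^sup>2 * A x x + p * q * A x y + p * q * A y x + q\<^sup>2 * A y y"
    by (simp add: A_def z_def sum_distrib_left sum.distrib [symmetric] algebra_simps power2_eq_square)
  ultimately have "p\<^sup>2 * A x x + 2 * p * q * A x y + q\<^sup>2 * A y y \<le> 0" using symA by simp
  then have "(p\<^sup>2 * A x x + 2 * p * q * A x y + q\<^sup>2 * A y y) * A y y \<le> 0"
    using Ay by (simp add: mult_nonpos_nonneg)
  \<comment> \<open>Completing the square. With a positive determinant this forces
    \<open>L y = 0\<close>, so \<open>y\<close> itself lies in the kernel, against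
    \<open>A y y > 0\<close>.\<close>
  moreover have "(p\<^sup>2 * A x x + 2 * p * q * A x y + q\<^sup>2 * A y y) * A y y
      = (q * A y y + p * A x y)\<^sup>2 + p\<^sup>2 * (A x x * A y y - (A x y)\<^sup>2)"
    by (simp add: algebra_simps power2_eq_square)
  moreover have "0 \<le> (q * A y y + p * A x y)\<^sup>2" by simp
  ultimately have "p\<^sup>2 * (A x x * A y y - (A x y)\<^sup>2) \<le> 0" by linarith
  then have "p = 0" using det by (simp add: mult_le_0_iff)
  then show False using neg[of y] Ay by (simp add: p_def L_def)
qed

text \<open>Tychonoff for a product of intervals.\<close>

lemma compact_function_box:
  fixes c :: "'a \<Rightarrow> real"
  shows "compact {u :: 'a \<Rightarrow> real. \<forall>i. \<bar>u i\<bar> \<le> c i}"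
proof -
  have "compactin (product_topology (\<lambda>i. euclidean) UNIV) (PiE UNIV (\<lambda>i. {- c i..c i}))"
    by (subst compactin_PiE) auto
  moreover have "PiE UNIV (\<lambda>i. {- c i..c i}) = {u. \<forall>i. \<bar>u i\<bar> \<le> c i}"
    by (auto simp: PiE_UNIV_domain abs_le_iff minus_le_iff)
  ultimately show ?thesis by (simp add: euclidean_product_topology)
qed

text \<open>The Rayleigh quotient is maximised on a compact weighted unit sphere, and homogeneity
  extends the bound to all \<open>y\<close>. The vector \<open>z\<close> ensures that the sphere is
  nonempty.\<close>

lemma weighted_quadratic_form_attains_sup:
  fixes b :: "'a \<Rightarrow> 'a \<Rightarrow> real" and w z :: "'a \<Rightarrow> real"
  assumes N: "finite N" and w: "\<And>i. i \<in> N \<Longrightarrow> 0 < w i"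
    and z: "(\<Sum>i\<in>N. w i * z i) = 0" and i: "i \<in> N" "z i \<noteq> 0"
  obtains u where "(\<Sum>i\<in>N. w i * u i) = 0" "(\<Sum>i\<in>N. w i * (u i)\<^sup>2) = 1"
    "\<And>y. (\<Sum>i\<in>N. w i * y i) = 0 \<Longrightarrow>
       (\<Sum>i\<in>N. \<Sum>j\<in>N. b i j * y i * y j)
       \<le> (\<Sum>i\<in>N. \<Sum>j\<in>N. b i j * u i * u j) * (\<Sum>i\<in>N. w i * (y i)\<^sup>2)"
proof -
  define q where "q y = (\<Sum>i\<in>N. \<Sum>j\<in>N. b i j * y i * y j)" for y
  define n where "n y = (\<Sum>i\<in>N. w i * (y i)\<^sup>2)" for y
  \<comment> \<open>Coordinates outside \<open>N\<close> do not enter the forms and are fixed to 0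
    for compactness. On \<open>N\<close> the norm condition bounds the square of \<open>u i\<close>
    by \<open>1 / w i\<close>; the larger bound \<open>1 + 1 / w i\<close> avoids a square
    root.\<close>
  define c where "c i = (if i \<in> N then 1 + 1 / w i else 0)" for i
  define S where "S = {u. \<forall>i. \<bar>u i\<bar> \<le> c i} \<inter> {u. n u = 1} \<inter> {u. (\<Sum>i\<in>N. w i * u i) = 0}"
  have cont: "continuous_on UNIV (\<lambda>u :: 'a \<Rightarrow> real. u i)" for i
    by (rule continuous_on_product_coordinates)
  have cont_n: "continuous_on UNIV n" and cont_q: "continuous_on UNIV q"
    unfolding n_def q_def by (intro continuous_intros cont)+
  have "compact S"
    unfolding S_def
    by (intro compact_Int_closed compact_function_box closed_Collect_eq cont_n
        continuous_intros cont)
  have n_nonneg: "0 \<le> n y" for y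
    unfolding n_def using w by (intro sum_nonneg mult_nonneg_nonneg) (auto intro: less_imp_le)
  have term_le: "w i * (y i)\<^sup>2 \<le> n y" if "i \<in> N" for i y
    unfolding n_def using that N w
    by (intro member_le_sum[of i N "\<lambda>i. w i * (y i)\<^sup>2"]) (simp_all add: less_imp_le)
  define nrm where "nrm y = (\<lambda>i. if i \<in> N then y i / sqrt (n y) else 0)" for y
  have q_nrm: "q (nrm y) = q y / n y" and nrm_S: "nrm y \<in> S"
    if y: "(\<Sum>i\<in>N. w i * y i) = 0" "n y > 0" for y
  proof -
    have sq: "sqrt (n y) * sqrt (n y) = n y" using n_nonneg by simp
    show "q (nrm y) = q y / n y"
      unfolding q_def nrm_def using sq
      by (simp add: sum_divide_distrib)
    have n1: "n (nrm y) = 1"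
    proof -
      have "n (nrm y) = (\<Sum>i\<in>N. w i * (y i)\<^sup>2 / n y)"
        unfolding n_def[of "nrm y"] using n_nonneg
        by (intro sum.cong) (auto simp: nrm_def power_divide)
      also have "\<dots> = n y / n y" by (simp only: n_def sum_divide_distrib)
      finally show ?thesis using y by simp
    qed
    have "\<bar>nrm y i\<bar> \<le> c i" for i
    proof (cases "i \<in> N")
      case True
      have "(nrm y i)\<^sup>2 \<le> 1 / w i"
        using term_le[OF True, of "nrm y"] n1 w[OF True] by (simp add: field_simps)
      also have "\<dots> \<le> (1 + 1 / w i)\<^sup>2"
        using w[OF True] self_le_power[of "1 + 1 / w i" 2] by simp
      finally show ?thesis
        using True w[OF True] by (simp add: c_def abs_le_square_iff[symmetric])
    qed (simp add: nrm_def c_def)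
    moreover have "(\<Sum>i\<in>N. w i * nrm y i) = (\<Sum>i\<in>N. w i * y i) / sqrt (n y)"
      by (simp add: nrm_def sum_divide_distrib)
    ultimately show "nrm y \<in> S" using n1 y by (simp add: S_def)
  qed
  have "n z > 0"
    using term_le[OF i(1), of z] w[OF i(1)] i(2)
    by (smt (verit) mult_pos_pos zero_less_power2)
  then have "S \<noteq> {}" using nrm_S z by blast
  then obtain u where u: "u \<in> S" "\<And>y. y \<in> S \<Longrightarrow> q y \<le> q u"
    using continuous_attains_sup[OF \<open>compact S\<close>, of q] cont_q continuous_on_subset by blast
  have "q y \<le> q u * n y" if y: "(\<Sum>i\<in>N. w i * y i) = 0" for y
  proof (cases "n y > 0")
    case True
    then show ?thesis using u(2)[OF nrm_S[OF y True]] q_nrm[OF y True] by (simp add: field_simps)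
  next
    case False
    have "y i = 0" if "i \<in> N" for i
      using term_le[OF that, of y] w[OF that] False
      by (smt (verit) mult_pos_pos zero_less_power2)
    then show ?thesis by (simp add: q_def n_def)
  qed
  then show ?thesis using u(1) that[of u] by (simp add: S_def q_def n_def)
qed

text \<open>
  A maximiser \<open>u\<close> of the form on the unit sphere of the complement is an eigenvector of the
  stochastic matrix \<open>b i j / w i\<close>, and a positive eigenvalue is at least 1 by \<open>bochner\<close>. The Dirichlet
  form \<open>\<Sum>\<^sub>i\<^sub>j b i j (u i - u j)\<^sup>2\<close> then vanishes, so \<open>u\<close> is constant.
\<close>

lemma bochner_nonpos_on_complement:
  fixes b :: "'a \<Rightarrow> 'a \<Rightarrow> real" and w z :: "'a \<Rightarrow> real"
  assumes N: "finite N"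
    and sym: "\<And>i j. b i j = b j i"
    and nonneg: "\<And>i j. i \<in> N \<Longrightarrow> j \<in> N \<Longrightarrow> 0 \<le> b i j"
    and rowsum: "\<And>i. i \<in> N \<Longrightarrow> (\<Sum>j\<in>N. b i j) = w i"
    and w: "\<And>i. i \<in> N \<Longrightarrow> 0 < w i"
    and bochner: "\<And>u. (\<Sum>i\<in>N. \<Sum>j\<in>N. b i j * u i * u j) \<le> (\<Sum>i\<in>N. (\<Sum>j\<in>N. b i j * u j)\<^sup>2 / w i)"
    and conn: "\<And>i j. i \<in> N \<Longrightarrow> j \<in> N \<Longrightarrow> 0 < b i j \<or> (\<exists>k\<in>N. 0 < b i k \<and> 0 < b j k)"
    and z: "(\<Sum>i\<in>N. w i * z i) = 0"
  shows "(\<Sum>i\<in>N. \<Sum>j\<in>N. b i j * z i * z j) \<le> 0"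
proof (rule ccontr)
  assume pos: "\<not> ?thesis"
  have "\<exists>i\<in>N. z i \<noteq> 0"
  proof (rule ccontr)
    assume "\<not> ?thesis"
    then show False using pos by simp
  qed
  then obtain i0 where i0: "i0 \<in> N" "z i0 \<noteq> 0" by blast
  define B where "B x y = (\<Sum>i\<in>N. \<Sum>j\<in>N. b i j * x i * y j)" for x y
  define P where "P x y = (\<Sum>i\<in>N. w i * x i * y i)" for x y
  obtain u where u0: "(\<Sum>i\<in>N. w i * u i) = 0" and u1: "(\<Sum>i\<in>N. w i * (u i)\<^sup>2) = 1"
    and max: "\<And>y. (\<Sum>i\<in>N. w i * y i) = 0 \<Longrightarrow>
       (\<Sum>i\<in>N. \<Sum>j\<in>N. b i j * y i * y j)
       \<le> (\<Sum>i\<in>N. \<Sum>j\<in>N. b i j * u i * u j) * (\<Sum>i\<in>N. w i * (y i)\<^sup>2)"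
    using weighted_quadratic_form_attains_sup[OF N w z i0, of b] by blast
  define \<mu> where "\<mu> = B u u"
  have P_sq: "P y y = (\<Sum>i\<in>N. w i * (y i)\<^sup>2)" for y
    by (simp add: P_def power2_eq_square mult_ac)
  have maxB: "B y y \<le> \<mu> * P y y" if "(\<Sum>i\<in>N. w i * y i) = 0" for y
    using max[OF that] by (simp add: \<mu>_def B_def P_sq)
  have Puu: "P u u = 1" using u1 by (simp add: P_sq)
  have "0 < B z z" using pos by (simp add: B_def)
  also have "B z z \<le> \<mu> * P z z" using maxB z by blast
  finally have "0 < \<mu> * P z z" .
  moreover have "0 \<le> P z z" unfolding P_sq using w by (intro sum_nonneg) (simp add: less_imp_le)
  ultimately have \<mu>: "0 < \<mu>" by (simp add: zero_less_mult_iff)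
  have Bsym: "B y x = B x y" for x y
    unfolding B_def by (subst sum.swap) (auto intro!: sum.cong simp: sym mult_ac)
  have Badd: "B (\<lambda>i. x i + t * y i) (\<lambda>i. x i + t * y i) = B x x + 2 * t * B x y + t\<^sup>2 * B y y" for x y t
  proof -
    have "B (\<lambda>i. x i + t * y i) (\<lambda>i. x i + t * y i) = B x x + t * B x y + t * B y x + t\<^sup>2 * B y y"
      by (simp add: B_def sum_distrib_left sum.distrib [symmetric] algebra_simps power2_eq_square)
    then show ?thesis by (simp add: Bsym[of x y])
  qed
  have Padd: "P (\<lambda>i. x i + t * y i) (\<lambda>i. x i + t * y i) = P x x + 2 * t * P x y + t\<^sup>2 * P y y" for x y t
    by (simp add: P_def sum_distrib_left sum.distrib [symmetric] algebra_simps power2_eq_square)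
  \<comment> \<open>Maximality of \<open>u\<close> along the line \<open>u + t y\<close>, which
    stays in the complement, makes the coefficient of \<open>t\<close> vanish.\<close>
  have crit: "B u y = \<mu> * P u y" if y: "(\<Sum>i\<in>N. w i * y i) = 0" for y
  proof -
    have "t * (2 * (B u y - \<mu> * P u y)) \<le> t\<^sup>2 * (\<mu> * P y y - B y y)" for t
    proof -
      have "(\<Sum>i\<in>N. w i * (u i + t * y i)) = (\<Sum>i\<in>N. w i * u i) + t * (\<Sum>i\<in>N. w i * y i)"
        by (simp add: sum_distrib_left sum.distrib [symmetric] algebra_simps)
      then have "(\<Sum>i\<in>N. w i * (u i + t * y i)) = 0" using u0 y by simp
      from maxB[OF this] show ?thesis
        unfolding Badd Padd Puu \<mu>_def[symmetric] by (simp add: algebra_simps)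
    qed
    from linear_le_quadratic_imp_zero[OF this] show ?thesis by simp
  qed
  \<comment> \<open>By \<open>rowsum\<close> the constants are eigenvectors for the eigenvalue 1,
    hence orthogonal to \<open>u\<close> in both forms.\<close>
  have B1: "B u (\<lambda>_. t) = 0" and P1: "P u (\<lambda>_. t) = 0" for t
  proof -
    have "B u (\<lambda>_. t) = (\<Sum>i\<in>N. (\<Sum>j\<in>N. b i j) * u i) * t"
      by (simp add: B_def sum_distrib_right)
    also have "\<dots> = (\<Sum>i\<in>N. w i * u i) * t" by (simp add: rowsum)
    finally show "B u (\<lambda>_. t) = 0" using u0 by simp
    have "P u (\<lambda>_. t) = (\<Sum>i\<in>N. w i * u i) * t" by (simp add: P_def sum_distrib_right)
    then show "P u (\<lambda>_. t) = 0" using u0 by simp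
  qed
  have W: "0 < (\<Sum>i\<in>N. w i)" using N w i0 by (intro sum_pos) auto
  have eigen: "(\<Sum>j\<in>N. b i j * u j) = \<mu> * w i * u i" if i: "i \<in> N" for i
  proof -
    \<comment> \<open>\<open>crit\<close> needs a vector in the complement: subtracting its weighted
      mean \<open>t\<close> moves the unit vector \<open>e\<close> there, and \<open>B1\<close> and
      \<open>P1\<close> remove the effect of \<open>t\<close>.\<close>
    define e where "e j = (if j = i then 1 else 0 :: real)" for j
    define t where "t = w i / (\<Sum>i\<in>N. w i)"
    have "(\<Sum>j\<in>N. w j * (e j - t)) = (\<Sum>j\<in>N. w j * e j) - (\<Sum>j\<in>N. w j) * t"
      by (simp add: right_diff_distrib sum_subtractf sum_distrib_right)
    also have "\<dots> = 0" using N i W by (simp add: e_def t_def if_distrib cong: if_cong)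
    finally have "B u (\<lambda>j. e j - t) = \<mu> * P u (\<lambda>j. e j - t)" by (rule crit)
    moreover have "B u (\<lambda>j. e j - t) = B u e - B u (\<lambda>_. t)"
      by (simp add: B_def sum_subtractf right_diff_distrib)
    moreover have "P u (\<lambda>j. e j - t) = P u e - P u (\<lambda>_. t)"
      by (simp add: P_def sum_subtractf right_diff_distrib)
    ultimately have "B u e = \<mu> * P u e" by (simp add: B1 P1)
    moreover have "B u e = (\<Sum>j\<in>N. b i j * u j)"
      unfolding B_def using N i by (simp add: e_def if_distrib sum.delta cong: if_cong) (simp add: sym)
    moreover have "P u e = w i * u i" unfolding P_def using N i by (simp add: e_def if_distrib cong: if_cong)
    ultimately show ?thesis by simp
  qed
  \<comment> \<open>Substituting \<open>eigen\<close> turns \<open>bochner\<close> into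
    \<open>\<mu> \<le> \<mu>\<^sup>2\<close>.\<close>
  have "\<mu> \<le> (\<Sum>i\<in>N. (\<Sum>j\<in>N. b i j * u j)\<^sup>2 / w i)"
    using bochner[of u] by (simp add: \<mu>_def B_def)
  also have "\<dots> = (\<Sum>i\<in>N. \<mu>\<^sup>2 * (w i * (u i)\<^sup>2))"
  proof (intro sum.cong refl)
    fix i assume "i \<in> N"
    then show "(\<Sum>j\<in>N. b i j * u j)\<^sup>2 / w i = \<mu>\<^sup>2 * (w i * (u i)\<^sup>2)"
      unfolding eigen[OF \<open>i \<in> N\<close>] using w[of i] by (simp add: power2_eq_square)
  qed
  also have "\<dots> = \<mu>\<^sup>2" by (simp add: sum_distrib_left [symmetric] u1)
  finally have \<mu>1: "1 \<le> \<mu>" using \<mu> by (simp add: power2_eq_square)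
  have sq: "(\<Sum>i\<in>N. \<Sum>j\<in>N. b i j * (u i - u j)\<^sup>2) = 2 - 2 * \<mu>"
  proof -
    have 1: "(\<Sum>i\<in>N. \<Sum>j\<in>N. b i j * (u i)\<^sup>2) = 1"
      using u1 by (simp add: sum_distrib_right [symmetric] rowsum)
    have 2: "(\<Sum>i\<in>N. \<Sum>j\<in>N. b i j * (u j)\<^sup>2) = 1"
      by (subst sum.swap) (use 1 in \<open>simp add: sym\<close>)
    have "(\<Sum>i\<in>N. \<Sum>j\<in>N. b i j * (u i - u j)\<^sup>2)
        = (\<Sum>i\<in>N. \<Sum>j\<in>N. b i j * (u i)\<^sup>2) + (\<Sum>i\<in>N. \<Sum>j\<in>N. b i j * (u j)\<^sup>2) - 2 * B u u"
      unfolding B_def sum_distrib_left sum.distrib [symmetric] sum_subtractf [symmetric]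
      by (intro sum.cong refl) (simp add: power2_eq_square algebra_simps)
    then show ?thesis using 1 2 by (simp add: \<mu>_def)
  qed
  have eq_b: "u i = u j" if ij: "i \<in> N" "j \<in> N" "0 < b i j" for i j
  proof (rule ccontr)
    assume "u i \<noteq> u j"
    then have "0 < b i j * (u i - u j)\<^sup>2" using ij by simp
    also have "\<dots> \<le> (\<Sum>j\<in>N. b i j * (u i - u j)\<^sup>2)"
      using N ij nonneg by (intro member_le_sum) auto
    also have "\<dots> \<le> (\<Sum>i\<in>N. \<Sum>j\<in>N. b i j * (u i - u j)\<^sup>2)"
      using N ij nonneg
      by (intro member_le_sum[of i N "\<lambda>i. \<Sum>j\<in>N. b i j * (u i - u j)\<^sup>2"]) (auto intro!: sum_nonneg)
    finally show False using sq \<mu>1 by simp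
  qed
  have const: "u i = u i0" if "i \<in> N" for i
    using conn[OF that i0(1)] eq_b that i0(1) by metis
  have "(\<Sum>i\<in>N. w i) * u i0 = (\<Sum>i\<in>N. w i * u i)" by (simp add: sum_distrib_right const)
  then have "u i0 = 0" using u0 W by simp
  then have "(\<Sum>i\<in>N. w i * (u i)\<^sup>2) = 0" using const by simp
  then show False using u1 by simp
qed

section \<open>Exchange, connectedness and rank two\<close>

text \<open>The exchange axiom prescribes the leaving element, here the entering \<open>j\<close> is
  prescribed. Starting from a basis \<open>A\<close> through \<open>j\<close>, the other elements of
  \<open>A - B\<close> are exchanged into \<open>B\<close> until only \<open>j\<close> remains; by
  cardinality \<open>A\<close> then misses a single \<open>b\<close> of \<open>B\<close>.\<close>

lemma basis_system_exchange_into: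
  assumes sys: "basis_system E r \<B>" and B: "B \<in> \<B>" and j: "j \<in> \<Union>\<B>" "j \<notin> B"
  obtains b where "b \<in> B" "insert j (B - {b}) \<in> \<B>"
proof -
  have sub: "finite A" "card A = r" if "A \<in> \<B>" for A
    using sys that finite_subset by (auto simp: basis_system_def)
  obtain A where "A \<in> \<B>" "j \<in> A" using j by blast
  then have "\<exists>b\<in>B. insert j (B - {b}) \<in> \<B>"
  proof (induction "card (A - B)" arbitrary: A rule: less_induct)
    case less
    show ?case
    proof (cases "A - B \<subseteq> {j}")
      case True
      have "card (B - (A - {j})) = card B - card (A - {j})"
        using True sub less.prems by (intro card_Diff_subset) auto
      also have "\<dots> = 1" using less.prems sub B card_gt_0_iff[of A] by fastforce
      finally obtain b where b: "B - (A - {j}) = {b}" by (rule card_1_singletonE)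
      then have "insert j (B - {b}) = A" using True less.prems j by blast
      then show ?thesis using b less.prems by blast
    next
      case False
      then obtain a where a: "a \<in> A - B" "a \<noteq> j" by blast
      then obtain b where b: "b \<in> B - A" "insert b (A - {a}) \<in> \<B>"
        using sys less.prems B by (auto simp: basis_system_def) blast
      have "insert b (A - {a}) - B = (A - B) - {a}" using b by blast
      then have "card (insert b (A - {a}) - B) < card (A - B)"
        using a sub less.prems by (metis card_Diff1_less finite_Diff)
      then show ?thesis using less.hyps b less.prems a by blast
    qed
  qed
  then show ?thesis using that by blast
qed

text \<open>This is the connectedness that makes the eigenvalue 1 simple. Exchanging
  \<open>j\<close> into a basis through \<open>i\<close> expels either another element, leaving
  \<open>i\<close> and \<open>j\<close> together, or \<open>i\<close> itself, leaving a common
  neighbour \<open>k\<close>.\<close>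

lemma basis_system_connected:
  assumes sys: "basis_system E (Suc (Suc r)) \<B>" and ij: "i \<in> \<Union>\<B>" "j \<in> \<Union>\<B>"
  obtains (joint) A where "i \<noteq> j" "A \<in> \<B>" "i \<in> A" "j \<in> A"
  | (path) k A B where "k \<noteq> i" "k \<noteq> j" "A \<in> \<B>" "i \<in> A" "k \<in> A" "B \<in> \<B>" "j \<in> B" "k \<in> B"
proof -
  obtain A where A: "A \<in> \<B>" "i \<in> A" using ij by blast
  have "card A = Suc (Suc r)" using sys A by (auto simp: basis_system_def)
  then have "card (A - {i}) = Suc r" using A by (simp add: card_Diff_singleton)
  then obtain k where k: "k \<in> A" "k \<noteq> i"
    by (metis Diff_iff card.empty equals0I nat.distinct(1) singletonI)
  show ?thesis
  proof (cases "j \<in> A")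
    case True
    \<comment> \<open>For \<open>i = j\<close> the path uses \<open>A\<close> twice.\<close>
    then show ?thesis using joint path A k by metis
  next
    case False
    obtain b where b: "b \<in> A" "insert j (A - {b}) \<in> \<B>"
      using basis_system_exchange_into[OF sys A(1) ij(2) False] .
    show ?thesis
    proof (cases "b = i")
      case True
      then show ?thesis using path[of k A "insert j (A - {b})"] A k b False by auto
    next
      case False
      then show ?thesis using joint[of "insert j (A - {b})"] A b \<open>j \<notin> A\<close> by auto
    qed
  qed
qed

text \<open>
  In rank 2, being parallel is an equivalence relation on the non-loops, so the form is
  \<open>(\<Sum>\<^sub>i z i)\<^sup>2 - \<Sum>\<^sub>C (\<Sum>\<^bsub>i\<in>C\<^esub> z i)\<^sup>2\<close> with \<open>C\<close> ranging over the parallel classes.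
\<close>

lemma basis_system_two_nonpositive:
  assumes sys: "basis_system E 2 \<B>"
    and z: "(\<Sum>i\<in>E. (if i \<in> \<Union>\<B> then 1 else 0) * z i) = 0"
  shows "basis_form E \<B> [z, z] \<le> 0"
proof -
  define N where "N = \<Union>\<B>"
  have card2: "card B = 2" if "B \<in> \<B>" for B
    using sys that by (auto simp: basis_system_def)
  have N: "finite N" and E: "finite E" and NE: "N \<subseteq> E"
    using sys finite_subset[of N E] by (auto simp: basis_system_def N_def)
  have z0: "(\<Sum>i\<in>N. z i) = 0"
  proof -
    have "(\<Sum>i\<in>N. z i) = (\<Sum>i\<in>E. (if i \<in> \<Union>\<B> then 1 else 0) * z i)"
      using E NE by (intro sum.mono_neutral_cong_left) (auto simp: N_def)
    then show ?thesis using z by simp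
  qed
  \<comment> \<open>The parallel class of \<open>i\<close>, serving as its own label.\<close>
  define h where "h i = {j \<in> N. {i, j} \<notin> \<B>}" for i
  have nsing: "{i} \<notin> \<B>" for i using card2[of "{i}"] by auto
  \<comment> \<open>Transitivity of parallelism in contrapositive form, by exchanging
    \<open>j\<close> into the basis \<open>{i, k}\<close>.\<close>
  have ext: "{i, j} \<in> \<B> \<or> {j, k} \<in> \<B>" if ikj: "{i, k} \<in> \<B>" "j \<in> N" for i j k
  proof (cases "j \<in> {i, k}")
    case True
    then show ?thesis using that by (auto simp: insert_commute)
  next
    case False
    have ik: "i \<noteq> k" using that nsing by auto
    obtain b where "b \<in> {i, k}" "insert j ({i, k} - {b}) \<in> \<B>"
      using basis_system_exchange_into[OF sys ikj(1) _ False] ikj(2) by (auto simp: N_def)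
    then show ?thesis using ik by (auto simp: insert_commute insert_Diff_if)
  qed
  have h_iff: "h i = h j \<longleftrightarrow> {i, j} \<notin> \<B>" if "i \<in> N" "j \<in> N" for i j
  proof
    assume "h i = h j"
    then show "{i, j} \<notin> \<B>" using that nsing by (auto simp: h_def)
  next
    assume ij: "{i, j} \<notin> \<B>"
    have "{i, k} \<notin> \<B> \<longleftrightarrow> {j, k} \<notin> \<B>" if "k \<in> N" for k
      using ij ext[of i k j] ext[of j k i] \<open>i \<in> N\<close> \<open>j \<in> N\<close> by (metis insert_commute)
    then show "h i = h j" by (auto simp: h_def)
  qed
  have coeff: "basis_form E (contract j (contract i \<B>)) [] = (if h i = h j then 0 else 1)"
    if "i \<in> N" "j \<in> N" for i j
    using h_iff[OF that] nsing by (auto simp: contract_def insert_commute)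
  have zero: "basis_form E (contract j (contract i \<B>)) [] = 0" if "i \<notin> N \<or> j \<notin> N" for i j
    using that by (auto simp: contract_def N_def)
  have "basis_form E \<B> [z, z]
      = (\<Sum>i\<in>E. \<Sum>j\<in>E. basis_form E (contract j (contract i \<B>)) [] * z i * z j)"
    by (simp add: sum_distrib_left mult_ac)
  also have "\<dots> = (\<Sum>i\<in>N. \<Sum>j\<in>N. basis_form E (contract j (contract i \<B>)) [] * z i * z j)"
    using E NE zero
    by (intro sum.mono_neutral_cong_right ballI sum.neutral) auto
  also have "\<dots> = (\<Sum>i\<in>N. \<Sum>j\<in>N. z i * z j - (if h i = h j then z i * z j else 0))"
    by (intro sum.cong refl) (simp add: coeff del: basis_form.simps)
  also have "\<dots> = (\<Sum>i\<in>N. z i) * (\<Sum>j\<in>N. z j) - (\<Sum>i\<in>N. \<Sum>j\<in>N. if h i = h j then z i * z j else 0)"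
    by (simp add: sum_subtractf sum_product)
  also have "(\<Sum>i\<in>N. \<Sum>j\<in>N. if h i = h j then z i * z j else 0)
      = (\<Sum>i\<in>N. z i * (\<Sum>j | j \<in> N \<and> h j = h i. z j))"
    using N by (intro sum.cong refl) (auto simp: sum_distrib_left intro!: sum.mono_neutral_cong_right split: if_splits)
  also have "\<dots> = (\<Sum>C\<in>h ` N. \<Sum>i | i \<in> N \<and> h i = C. z i * (\<Sum>j | j \<in> N \<and> h j = h i. z j))"
    by (rule sum.image_gen[OF N])
  also have "\<dots> = (\<Sum>C\<in>h ` N. (\<Sum>i | i \<in> N \<and> h i = C. z i)\<^sup>2)"
    by (intro sum.cong refl) (simp add: power2_eq_square sum_distrib_right cong: conj_cong)
  finally show ?thesis using z0 by (simp add: sum_nonneg)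
qed

section \<open>The Alexandrov--Fenchel inequality\<close>

text \<open>The sign of \<open>x\<close> is left free because the Bochner inequality is needed at
  every \<open>u\<close>. Non-negativity of \<open>y\<close> supplies the hypothesis
  \<open>0 \<le> A y y\<close> of \<open>reverse_cauchy_schwarz\<close>; in the induction hypothesis
  \<open>y\<close> becomes \<open>v\<close>.\<close>

lemma basis_form_alexandrov_fenchel_pos:
  assumes "basis_system E (Suc (Suc (length ws))) \<B>"
    and "\<And>v i. v \<in> set ws \<Longrightarrow> i \<in> E \<Longrightarrow> 0 < v i"
    and "\<And>i. i \<in> E \<Longrightarrow> 0 \<le> y i"
  shows "basis_form E \<B> (x # x # ws) * basis_form E \<B> (y # y # ws) \<le> (basis_form E \<B> (x # y # ws))\<^sup>2"
  using assms
proof (induction ws arbitrary: \<B> x y)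
  case (Nil \<B> x y)
  define a where "a i j = basis_form E (contract j (contract i \<B>)) []" for i j
  have form: "basis_form E \<B> [x, y] = (\<Sum>i\<in>E. \<Sum>j\<in>E. a i j * x i * y j)" for x y
    by (simp add: sum_distrib_left a_def mult_ac)
  have sys: "basis_system E 2 \<B>" using Nil by (simp add: numeral_2_eq_2)
  have a_sym: "a i j = a j i" for i j by (simp add: a_def contract_commute)
  have "0 \<le> basis_form E \<B> [y, y]" using Nil by (intro basis_form_nonneg) auto
  then show ?case
    unfolding form
    by (intro reverse_cauchy_schwarz[where l = "\<lambda>i. if i \<in> \<Union>\<B> then 1 else 0"] a_sym)
      (use basis_system_two_nonpositive[OF sys, unfolded form] in \<open>simp_all only:\<close>)
next
  case (Cons v ws \<B> x y)
  define N where "N = \<Union>\<B>"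
  have E: "finite E" and NE: "N \<subseteq> E" and N: "finite N"
    using Cons.prems(1) finite_subset[of N E] by (auto simp: basis_system_def N_def)
  have v: "0 < v i" if "i \<in> E" for i using Cons.prems(2) that by simp
  note sys_contract = basis_system_contract[OF Cons.prems(1)]
  define a where "a i j = basis_form E (contract j (contract i \<B>)) (v # ws)" for i j
  have form: "basis_form E \<B> (x # y # v # ws) = (\<Sum>i\<in>E. \<Sum>j\<in>E. a i j * x i * y j)" for x y
    by (simp add: sum_distrib_left a_def mult_ac)
  have form1: "basis_form E (contract i \<B>) (x # v # ws) = (\<Sum>j\<in>N. a i j * x j)" for i x
  proof -
    have "basis_form E (contract i \<B>) (x # v # ws) = (\<Sum>j\<in>E. a i j * x j)"
      by (simp add: a_def mult_ac)
    also have "\<dots> = (\<Sum>j\<in>N. a i j * x j)"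
      using E NE contract_nonbasis
      by (intro sum.mono_neutral_right) (auto simp: a_def N_def contract_commute[of _ i] contract_nonbasis)
    finally show ?thesis .
  qed
  have form2: "basis_form E \<B> (x # y # v # ws) = (\<Sum>i\<in>N. \<Sum>j\<in>N. a i j * x i * y j)" for x y
  proof -
    have "basis_form E \<B> (x # y # v # ws) = (\<Sum>i\<in>E. x i * basis_form E (contract i \<B>) (y # v # ws))"
      by (rule basis_form.simps)
    also have "\<dots> = (\<Sum>i\<in>N. x i * basis_form E (contract i \<B>) (y # v # ws))"
      using E NE by (intro sum.mono_neutral_right) (auto simp: N_def contract_nonbasis)
    finally show ?thesis by (simp only: form1) (simp add: sum_distrib_left mult_ac)
  qed
  \<comment> \<open>Summing \<open>d i * z i\<close> gives F(z, v, v, w'), so the kernel of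
    \<open>d\<close> is the complement of \<open>v\<close> under the form.\<close>
  define d where "d i = basis_form E (contract i \<B>) (v # v # ws)" for i
  have d_pos: "0 < d i" if i: "i \<in> N" for i
  proof -
    obtain B where B: "B \<in> \<B>" "i \<in> B" using i by (auto simp: N_def)
    then have "B - {i} \<in> contract i \<B>" by (rule contract_in_basis)
    then show ?thesis
      unfolding d_def using sys_contract[of i] Cons.prems(2) E
      by (intro basis_form_pos[of E "B - {i}"]) (auto simp: basis_system_def)
  qed
  have a_sym: "a i j = a j i" for i j by (simp add: a_def contract_commute)
  have a_nonneg: "0 \<le> a i j" for i j
    unfolding a_def using Cons.prems(2) by (intro basis_form_nonneg) (simp_all add: less_imp_le)
  have a_pos: "0 < a i j" if "i \<noteq> j" "B \<in> \<B>" "i \<in> B" "j \<in> B" for i j B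
  proof -
    have "B - {i} - {j} \<in> contract j (contract i \<B>)"
      using that by (intro contract_in_basis) auto
    then show ?thesis
      unfolding a_def using basis_system_contract[OF sys_contract[of i, simplified], of j] Cons.prems(2) E
      by (intro basis_form_pos[of E "B - {i} - {j}"]) (auto simp: basis_system_def)
  qed
  \<comment> \<open>The substitution of \<open>v j * u j\<close> for the argument gives
    \<open>b\<close> the row sums \<open>w\<close>, and the eigenvector \<open>v\<close> becomes the
    constant 1.\<close>
  define b where "b i j = a i j * v i * v j" for i j
  define w where "w i = v i * d i" for i
  have w_pos: "0 < w i" if "i \<in> N" for i using v d_pos that NE by (auto simp: w_def)
  have b_pos: "0 < b i j" if "i \<noteq> j" "B \<in> \<B>" "i \<in> B" "j \<in> B" for i j B
    using a_pos[OF that] v[of i] v[of j] that NE by (auto simp: b_def N_def intro!: mult_pos_pos)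
  have b_row: "(\<Sum>j\<in>N. b i j * u j) = v i * basis_form E (contract i \<B>) ((\<lambda>j. v j * u j) # v # ws)"
    for i u
    by (simp only: form1) (simp add: b_def sum_distrib_left mult_ac)
  have bochner: "(\<Sum>i\<in>N. \<Sum>j\<in>N. b i j * u i * u j) \<le> (\<Sum>i\<in>N. (\<Sum>j\<in>N. b i j * u j)\<^sup>2 / w i)" for u
  proof -
    define x where "x = (\<lambda>j. v j * u j)"
    have "(\<Sum>i\<in>N. \<Sum>j\<in>N. b i j * u i * u j) = basis_form E \<B> (x # x # v # ws)"
      unfolding form2 by (intro sum.cong refl) (simp add: b_def x_def)
    \<comment> \<open>With \<open>v\<close> in front, expanding into contractions leaves the shorter
      list \<open>ws\<close> to the induction hypothesis.\<close>
    also have "\<dots> = basis_form E \<B> (v # x # x # ws)"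
      using basis_form_move_front[of E \<B> "[x, x]" v ws] by simp
    also have "\<dots> = (\<Sum>i\<in>E. v i * basis_form E (contract i \<B>) (x # x # ws))"
      by (rule basis_form.simps)
    also have "\<dots> = (\<Sum>i\<in>N. v i * basis_form E (contract i \<B>) (x # x # ws))"
      using E NE by (intro sum.mono_neutral_right) (auto simp: N_def contract_nonbasis)
    also have "\<dots> \<le> (\<Sum>i\<in>N. (\<Sum>j\<in>N. b i j * u j)\<^sup>2 / w i)"
    proof (rule sum_mono)
      fix i assume i: "i \<in> N"
      define f where "f = basis_form E (contract i \<B>) (x # v # ws)"
      have "basis_form E (contract i \<B>) (x # x # ws) * d i \<le> f\<^sup>2"
        unfolding d_def f_def
        using sys_contract[of i] Cons.prems(2) by (intro Cons.IH) (auto intro: less_imp_le)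
      then have "basis_form E (contract i \<B>) (x # x # ws) \<le> f\<^sup>2 / d i"
        using d_pos[OF i] by (simp add: pos_le_divide_eq)
      then have "v i * basis_form E (contract i \<B>) (x # x # ws) \<le> v i * (f\<^sup>2 / d i)"
        using v[of i] i NE by (intro mult_left_mono) (auto intro: less_imp_le)
      also have "\<dots> = (v i * f)\<^sup>2 / w i"
        using v[of i] i NE by (auto simp: w_def power2_eq_square)
      finally show "v i * basis_form E (contract i \<B>) (x # x # ws) \<le> (\<Sum>j\<in>N. b i j * u j)\<^sup>2 / w i"
        by (simp only: b_row f_def x_def)
    qed
    finally show ?thesis .
  qed
  have conn: "0 < b i j \<or> (\<exists>k\<in>N. 0 < b i k \<and> 0 < b j k)" if "i \<in> N" "j \<in> N" for i j
    using Cons.prems(1)[unfolded list.size(4) add_Suc_right] that[unfolded N_def]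
  proof (cases rule: basis_system_connected)
    case (joint A)
    then show ?thesis using b_pos by blast
  next
    case (path k A B)
    then have "k \<in> N" "0 < b i k" "0 < b j k" using b_pos by (auto simp: N_def)
    then show ?thesis by blast
  qed
  have neg: "basis_form E \<B> (z # z # v # ws) \<le> 0" if z: "(\<Sum>i\<in>E. d i * z i) = 0" for z
  proof -
    \<comment> \<open>Undoing the substitution turns the condition on \<open>d\<close> and
      \<open>z\<close> into orthogonality of \<open>u\<close> to the weights
      \<open>w\<close>.\<close>
    define u where "u i = z i / v i" for i
    have uz: "v i * u i = z i" if "i \<in> N" for i using v[of i] that NE by (auto simp: u_def)
    have "(\<Sum>i\<in>N. w i * u i) = (\<Sum>i\<in>N. d i * z i)"
      using uz by (intro sum.cong refl) (simp add: w_def mult_ac)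
    also have "\<dots> = (\<Sum>i\<in>E. d i * z i)"
      using E NE by (intro sum.mono_neutral_left) (auto simp: N_def d_def contract_nonbasis)
    finally have "(\<Sum>i\<in>N. w i * u i) = 0" using z by simp
    then have "(\<Sum>i\<in>N. \<Sum>j\<in>N. b i j * u i * u j) \<le> 0"
    proof (intro bochner_nonpos_on_complement[OF N _ _ _ w_pos bochner conn])
      show "(\<Sum>j\<in>N. b i j) = w i" if "i \<in> N" for i
        using b_row[of i "\<lambda>_. 1"] by (simp add: w_def d_def)
      show "b i j = b j i" for i j by (simp add: b_def a_sym[of i j])
      show "0 \<le> b i j" if "i \<in> N" "j \<in> N" for i j
        unfolding b_def using that NE v[THEN less_imp_le]
        by (intro mult_nonneg_nonneg a_nonneg) auto
    qed auto
    also have "(\<Sum>i\<in>N. \<Sum>j\<in>N. b i j * u i * u j) = basis_form E \<B> (z # z # v # ws)"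
      unfolding form2 by (intro sum.cong refl) (simp add: b_def uz[symmetric])
    finally show ?thesis .
  qed
  have "0 \<le> basis_form E \<B> (y # y # v # ws)"
    using Cons.prems by (intro basis_form_nonneg) (auto intro: less_imp_le)
  then show ?case
    unfolding form
    by (intro reverse_cauchy_schwarz[where l = d] a_sym) (use neg in \<open>simp_all only: form\<close>)
qed

text \<open>Shifting every argument by \<open>e > 0\<close> makes all values on \<open>E\<close>
  positive, and the inequality survives the limit as \<open>e\<close> tends to 0.\<close>

lemma basis_form_alexandrov_fenchel:
  assumes "basis_system E (Suc (Suc (length ws))) \<B>"
    and "\<And>v i. v \<in> set (x # y # ws) \<Longrightarrow> i \<in> E \<Longrightarrow> 0 \<le> v i"
  shows "basis_form E \<B> (x # x # ws) * basis_form E \<B> (y # y # ws) \<le> (basis_form E \<B> (x # y # ws))\<^sup>2"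
proof -
  define g where "g vs e = basis_form E \<B> (map (\<lambda>v i. v i + e) vs)" for vs and e :: real
  have g: "(g vs \<longlongrightarrow> basis_form E \<B> vs) (at_right 0)" for vs
    using isCont_basis_form_shift[of 0 E \<B> vs]
    unfolding g_def by (simp add: isCont_def filterlim_at_split)
  have "g (x # x # ws) e * g (y # y # ws) e \<le> (g (x # y # ws) e)\<^sup>2" if "e > 0" for e
    unfolding g_def list.map using assms that
    by (intro basis_form_alexandrov_fenchel_pos) (auto intro!: add_nonneg_pos)
  then have "\<forall>\<^sub>F e in at_right 0. g (x # x # ws) e * g (y # y # ws) e \<le> (g (x # y # ws) e)\<^sup>2"
    by (simp add: eventually_at_right_less eventually_mono[OF eventually_at_right_less])
  then show ?thesis
    by (intro tendsto_le[OF _ tendsto_power[OF g] tendsto_mult[OF g g]]) simp_all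
qed

section \<open>Log-concavity of the basis counts\<close>

lemma (in matroid) basis_system: "basis_system E (matroid_rank \<B>) \<B>"
  using finite_ground basis_subset card_basis basis_exchange by (simp add: basis_system_def)

theorem theorem3p3p15:
  fixes E :: "'a set" and \<B> :: "'a set set" and r m :: nat
    and T :: "'a set list" and Q R :: "'a set"
  assumes "matroid E \<B>"
    and "matroid_rank \<B> = r"
    and "m \<le> r"
    and "length T = r - m"
    and "\<And>S. S \<in> set T \<Longrightarrow> S \<subseteq> E"
    and "Q \<subseteq> E"
    and "R \<subseteq> E"
  shows "log_concave m (\<lambda>k. real (mixed_basis_count \<B> m T Q R k))"
proof -
  interpret matroid E \<B> by fact
  have count: "real (mixed_basis_count \<B> m T Q R k)
      = basis_form E \<B> (map indicator (T @ replicate k Q @ replicate (m - k) R))" if "k \<le> m" for k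
    unfolding mixed_basis_count_def
    using assms that by (intro basis_count_eq_basis_form finite_ground) (auto simp: card_basis)
  have "real (mixed_basis_count \<B> m T Q R (k - 1)) * real (mixed_basis_count \<B> m T Q R (k + 1))
      \<le> (real (mixed_basis_count \<B> m T Q R k))\<^sup>2" if k: "1 \<le> k" "k < m" for k
  proof -
    \<comment> \<open>The three counts share \<open>T\<close>, \<open>p\<close> copies of
      \<open>Q\<close> and \<open>q\<close> copies of \<open>R\<close>. The two remaining slots hold
      \<open>R, R\<close> for \<open>k - 1\<close>, \<open>Q, R\<close> for \<open>k\<close> and
      \<open>Q, Q\<close> for \<open>k + 1\<close>.\<close>
    obtain p where p: "k = Suc p" using k by (cases k) auto
    obtain q where q: "m = Suc (Suc (p + q))" using less_imp_Suc_add[OF k(2)] p by auto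
    define us vs ws :: "('a \<Rightarrow> real) list" where "us = map indicator (T @ replicate p Q)"
      and "vs = replicate q (indicator R)" and "ws = us @ vs"
    have move: "basis_form E \<B> (us @ x # y # vs) = basis_form E \<B> (x # y # ws)" for x y
      using basis_form_move_front[of E \<B> us x "y # vs"] basis_form_move_front[of E \<B> "x # us" y vs]
        basis_form_swap[of E \<B> y x ws]
      by (simp only: append_Cons ws_def)
    have "real (mixed_basis_count \<B> m T Q R (k - 1)) = basis_form E \<B> (indicator R # indicator R # ws)"
      unfolding move[symmetric] by (subst count) (simp_all add: p q us_def vs_def)
    moreover have "real (mixed_basis_count \<B> m T Q R k) = basis_form E \<B> (indicator Q # indicator R # ws)"
      unfolding move[symmetric]
      by (subst count) (simp_all add: p q us_def vs_def replicate_app_Cons_same)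
    moreover have "real (mixed_basis_count \<B> m T Q R (k + 1)) = basis_form E \<B> (indicator Q # indicator Q # ws)"
      unfolding move[symmetric]
      by (subst count) (simp_all add: p q us_def vs_def replicate_app_Cons_same)
    moreover have "basis_form E \<B> (indicator Q # indicator Q # ws) * basis_form E \<B> (indicator R # indicator R # ws)
        \<le> (basis_form E \<B> (indicator Q # indicator R # ws))\<^sup>2"
    proof (rule basis_form_alexandrov_fenchel)
      have "Suc (Suc (length ws)) = r" using assms q by (simp add: ws_def us_def vs_def)
      then show "basis_system E (Suc (Suc (length ws))) \<B>" using basis_system assms(2) by simp
    qed (auto simp: ws_def us_def vs_def)
    ultimately show ?thesis by (simp add: mult.commute)
  qed
  then show ?thesis by (simp add: log_concave_def)
qed

end
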